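(* Let $M=(E,\mathcal{I})$ be a matroid with finite ground set $E$, let $m,\Delta$ be positive integers, and let each element $e\in E$ carry a weight vector $W(e)\in\{-\Delta,\dots,\Delta\}^m$. Let $A,B$ be bases of $M$. Then there exists a basis $A'$ of $M$ with $W(A')=W(A)$ and \[ |A'\oplus B| \le (2m\Delta)^{12m}\cdot \|W(B)-W(A)\|_1 . \]
   Context: For $S\subseteq E$, $W(S)=\sum_{e\in S}W(e)\in\mathbb{Z}^m$. For sets $X,Y$, $X\oplus Y=(X\setminus Y)\cup(Y\setminus X)$ denotes the symmetric difference. A basis of $M$ is an inclusion-wise maximal independent set. *)

theory Defs
  imports Main
begin

definition matroid :: "'a set \<Rightarrow> ('a set \<Rightarrow> bool) \<Rightarrow> bool" where
  "matroid E indep \<longleftrightarrow>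
     finite E \<and>
     (\<forall>X. indep X \<longrightarrow> X \<subseteq> E) \<and>
     indep {} \<and>
     (\<forall>X Y. indep X \<and> Y \<subseteq> X \<longrightarrow> indep Y) \<and>
     (\<forall>X Y. indep X \<and> indep Y \<and> card X < card Y \<longrightarrow>
        (\<exists>e \<in> Y - X. indep (insert e X)))"

definition basis :: "('a set \<Rightarrow> bool) \<Rightarrow> 'a set \<Rightarrow> bool" where
  "basis indep B \<longleftrightarrow> indep B \<and> (\<forall>X. indep X \<and> B \<subseteq> X \<longrightarrow> X = B)"

definition wsum :: "('a \<Rightarrow> nat \<Rightarrow> int) \<Rightarrow> 'a set \<Rightarrow> nat \<Rightarrow> int" where
  "wsum W S = (\<lambda>i. \<Sum>e\<in>S. W e i)"

definition symdiff :: "'a set \<Rightarrow> 'a set \<Rightarrow> 'a set" where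
  "symdiff X Y = (X - Y) \<union> (Y - X)"

end

theory Submission
  imports Defs Complex_Main
begin

text \<open>Choose \<open>A\<close> closest to \<open>B\<close> among the bases of the given weight, and put elements into
  classes according to their weight and their membership in \<open>A\<close> and \<open>B\<close>. By Rado's theorem a basis
  with prescribed class sizes exists iff no union \<open>Z\<close> of classes asks for more than its rank, and
  \<open>rank Z - |A \<inter> Z|\<close> is a nonnegative submodular function that bounds \<open>|B \<inter> Z| - |A \<inter> Z|\<close>.
  Call a pair \<open>e \<in> B - A\<close>, \<open>f \<in> A - B\<close> rich if this function is at least \<open>\<rho>\<close> on every \<open>Z\<close>
  that contains \<open>e\<close> but not \<open>f\<close>. Any \<open>\<rho>\<close> rich pairs can be exchanged simultaneously at the level
  of class sizes, and uncrossing with Hall's theorem matches all but a bounded number of elements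
  of \<open>B - A\<close> into rich pairs. If \<open>B - A\<close> is large, then so is the number of rich pairs compared with
  the sum of their weight differences, and the Steinitz lemma yields at most \<open>\<rho>\<close> of them whose
  weight differences cancel. Exchanging these gives a basis of the same weight closer to \<open>B\<close>.\<close>

section \<open>Zero-sum subsets of bounded vectors\<close>

text \<open>More unknowns than homogeneous equations. Gaussian elimination: a pivot \<open>p\<close>
  clears coordinate \<open>q\<close> from the other vectors, and the coefficient of \<open>p\<close>
  is recovered at the end.\<close>

lemma nontrivial_linear_relation:
  fixes f :: "'b \<Rightarrow> nat \<Rightarrow> real"
  assumes "finite S" "q < card S"
  shows "\<exists>c. (\<exists>x\<in>S. c x \<noteq> 0) \<and> (\<forall>j<q. (\<Sum>x\<in>S. c x * f x j) = 0)"
  using assms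
proof (induction q arbitrary: S f)
  case 0
  then have "S \<noteq> {}" by auto
  then show ?case by (intro exI[of _ "\<lambda>_. 1"]) auto
next
  case (Suc q)
  show ?case
  proof (cases "\<forall>x\<in>S. f x q = 0")
    case True
    obtain c where c: "\<exists>x\<in>S. c x \<noteq> 0" "\<forall>j<q. (\<Sum>x\<in>S. c x * f x j) = 0"
      using Suc.IH[of S f] Suc.prems by auto
    have "(\<Sum>x\<in>S. c x * f x q) = 0" using True by simp
    then show ?thesis using c by (intro exI[of _ c]) (auto simp: less_Suc_eq)
  next
    case False
    then obtain p where p: "p \<in> S" "f p q \<noteq> 0" by blast
    let ?S = "S - {p}"
    let ?f = "\<lambda>x j. f x j - f x q / f p q * f p j"
    have "finite ?S" "q < card ?S" using Suc.prems p by auto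
    from Suc.IH[OF this, of ?f] obtain c where c: "\<exists>x\<in>?S. c x \<noteq> 0"
      "\<forall>j<q. (\<Sum>x\<in>?S. c x * ?f x j) = 0" by blast
    define r where "r = - (\<Sum>x\<in>?S. c x * (f x q / f p q))"
    define d where "d = c(p := r)"
    have split: "(\<Sum>x\<in>S. d x * f x j) = (\<Sum>x\<in>?S. c x * ?f x j)" for j
    proof -
      have "(\<Sum>x\<in>S. d x * f x j) = r * f p j + (\<Sum>x\<in>?S. d x * f x j)"
        using Suc.prems p by (subst sum.remove[of S p]) (auto simp: d_def)
      also have "(\<Sum>x\<in>?S. d x * f x j) = (\<Sum>x\<in>?S. c x * f x j)"
        by (rule sum.cong) (auto simp: d_def)
      also have "r * f p j = - (\<Sum>x\<in>?S. c x * (f x q / f p q) * f p j)"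
        by (simp add: r_def sum_distrib_right)
      finally show ?thesis
        by (simp add: sum_subtractf algebra_simps)
    qed
    have "(\<Sum>x\<in>S. d x * f x j) = 0" if "j < Suc q" for j
    proof (cases "j = q")
      case True
      then show ?thesis using p by (simp add: split)
    next
      case False
      then show ?thesis using c(2) that by (simp add: split)
    qed
    moreover have "\<exists>x\<in>S. d x \<noteq> 0" using c(1) by (auto simp: d_def)
    ultimately show ?thesis by blast
  qed
qed

text \<open>The invariant of the Grinberg--Sevastyanov proof of the Steinitz lemma: the elements of
  \<open>S\<close> can be damped by a total amount of \<open>m\<close> such that the damped vectors cancel, so the plain sum
  over \<open>S\<close> is at most \<open>m\<close> times the size of a single vector.\<close>

definition balanced :: "nat \<Rightarrow> ('b \<Rightarrow> nat \<Rightarrow> real) \<Rightarrow> 'b set \<Rightarrow> bool" where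
  "balanced m u S \<longleftrightarrow> (\<exists>l. (\<forall>x\<in>S. 0 \<le> l x \<and> l x \<le> 1) \<and> (\<Sum>x\<in>S. l x) = real (card S) - real m \<and>
     (\<forall>j<m. (\<Sum>x\<in>S. l x * u x j) = 0))"

text \<open>A solution with fewest fractional entries acts as a vertex of the polytope. If no entry
  vanished, the remaining entries would all be 1, forcing more than \<open>m + 1\<close> fractional
  ones. Then some direction keeps all \<open>m + 1\<close> equations, and moving along it until an
  entry reaches 0 or 1 contradicts minimality.\<close>

lemma vanishing_coordinate:
  fixes u :: "'b \<Rightarrow> nat \<Rightarrow> real"
  assumes fin: "finite S"
    and ex: "\<exists>l. (\<forall>x\<in>S. 0 \<le> l x \<and> l x \<le> 1) \<and> (\<Sum>x\<in>S. l x) = real (card S) - real m - 1 \<and>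
     (\<forall>j<m. (\<Sum>x\<in>S. l x * u x j) = 0)"
  shows "\<exists>l. (\<forall>x\<in>S. 0 \<le> l x \<and> l x \<le> 1) \<and> (\<Sum>x\<in>S. l x) = real (card S) - real m - 1 \<and>
     (\<forall>j<m. (\<Sum>x\<in>S. l x * u x j) = 0) \<and> (\<exists>x\<in>S. l x = 0)"
proof -
  let ?P = "\<lambda>l. (\<forall>x\<in>S. 0 \<le> l x \<and> l x \<le> 1) \<and> (\<Sum>x\<in>S. l x) = real (card S) - real m - 1 \<and>
     (\<forall>j<m. (\<Sum>x\<in>S. l x * u x j) = 0)"
  let ?Fr = "\<lambda>l. {x\<in>S. 0 < l x \<and> l x < (1::real)}"
  from ex obtain l where l: "?P l" and least: "\<And>k. ?P k \<Longrightarrow> card (?Fr l) \<le> card (?Fr k)"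
    using ex_has_least_nat[of ?P _ "\<lambda>l. card (?Fr l)"] by blast
  have finF: "finite (?Fr l)" using fin by simp
  have "\<exists>x\<in>S. l x = 0"
  proof (rule ccontr)
    assume "\<not> ?thesis"
    then have pos: "0 < l x" if "x \<in> S" for x using l that by (metis less_eq_real_def)
    have "(\<Sum>x\<in>S. l x) = (\<Sum>x\<in>?Fr l. l x) + (\<Sum>x\<in>S - ?Fr l. l x)"
      using fin by (subst sum.subset_diff[of "?Fr l"]) auto
    also have "(\<Sum>x\<in>S - ?Fr l. l x) = (\<Sum>x\<in>S - ?Fr l. 1)"
      using pos l by (intro sum.cong) (auto simp: less_eq_real_def)
    also have "\<dots> = real (card S) - real (card (?Fr l))"
      using fin by (simp add: card_Diff_subset card_mono of_nat_diff)
    finally have sumF: "(\<Sum>x\<in>?Fr l. l x) = real (card (?Fr l)) - real m - 1"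
      using l by linarith
    have ne: "?Fr l \<noteq> {}"
    proof
      assume "?Fr l = {}"
      then have "0 = - real m - 1" using sumF by (simp only: sum.empty card.empty)
      then show False by linarith
    qed
    then have "0 < (\<Sum>x\<in>?Fr l. l x)" using finF by (intro sum_pos) auto
    then have big: "m + 1 < card (?Fr l)" using sumF by linarith
    \<comment> \<open>The extra coordinate \<open>m\<close>, constantly 1, makes the direction
      preserve the total of \<open>l\<close> as well.\<close>
    define f where "f = (\<lambda>x j. if j < m then u x j else 1)"
    obtain c where c0: "\<exists>x\<in>?Fr l. c x \<noteq> 0"
      and c: "\<forall>j<m+1. (\<Sum>x\<in>?Fr l. c x * f x j) = 0"
      using nontrivial_linear_relation[OF finF big, of f] by blast
    define C where "C = {x\<in>?Fr l. c x \<noteq> 0}"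
    \<comment> \<open>\<open>\<tau> x\<close> is the step length at which entry \<open>x\<close>
      reaches 1 (if it grows) or 0 (if it shrinks); the minimum \<open>t\<close> stops at the first
      such event.\<close>
    define \<tau> where "\<tau> = (\<lambda>x. if c x > 0 then (1 - l x) / c x else - l x / c x)"
    have finC: "finite C" "C \<noteq> {}" using c0 finF by (auto simp: C_def intro: finite_subset[OF _ finF])
    define t where "t = Min (\<tau> ` C)"
    have \<tau>pos: "\<tau> x > 0" if "x \<in> C" for x
      using that by (auto simp: C_def \<tau>_def zero_less_divide_iff divide_less_0_iff)
    have "t \<in> \<tau> ` C" using finC by (simp add: t_def)
    then obtain x0 where x0: "x0 \<in> C" "t = \<tau> x0" by blast
    have tpos: "t > 0" using \<tau>pos x0 by simp
    have tle: "t \<le> \<tau> x" if "x \<in> C" for x using finC that by (simp add: t_def)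
    define k where "k = (\<lambda>x. if x \<in> ?Fr l then l x + t * c x else l x)"
    have ksum: "(\<Sum>x\<in>S. k x * g x) = (\<Sum>x\<in>S. l x * g x) + t * (\<Sum>x\<in>?Fr l. c x * g x)" for g
    proof -
      have "(\<Sum>x\<in>S. k x * g x) = (\<Sum>x\<in>S. l x * g x + (if x \<in> ?Fr l then t * (c x * g x) else 0))"
        by (rule sum.cong) (auto simp: k_def algebra_simps)
      also have "\<dots> = (\<Sum>x\<in>S. l x * g x) + (\<Sum>x\<in>S \<inter> ?Fr l. t * (c x * g x))"
        using fin by (simp only: sum.distrib sum.inter_restrict)
      also have "S \<inter> ?Fr l = ?Fr l" by auto
      finally show ?thesis by (simp add: sum_distrib_left)
    qed
    have range: "0 \<le> k x \<and> k x \<le> 1" if "x \<in> S" for x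
    proof (cases "x \<in> ?Fr l")
      case xF: True
      show ?thesis
      proof (cases "c x = 0")
        case True then show ?thesis using xF by (simp add: k_def)
      next
        case False
        then have xC: "x \<in> C" using xF by (simp add: C_def)
        show ?thesis
        proof (cases "c x > 0")
          case True
          have "t \<le> (1 - l x) / c x" using tle[OF xC] True by (simp add: \<tau>_def)
          then have "t * c x \<le> 1 - l x" using True by (simp add: pos_le_divide_eq)
          then show ?thesis using True tpos xF by (simp add: k_def)
        next
          case neg: False
          then have "c x < 0" using False by linarith
          have "t \<le> - l x / c x" using tle[OF xC] neg by (simp add: \<tau>_def)
          then have "t * c x \<ge> - l x" using \<open>c x < 0\<close> by (simp add: field_simps)
          moreover have "t * c x \<le> 0" using \<open>c x < 0\<close> tpos by (simp add: mult_nonneg_nonpos)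
          ultimately show ?thesis using xF by (auto simp: k_def)
        qed
      qed
    next
      case False
      then show ?thesis using l that by (auto simp: k_def)
    qed
    have s1: "(\<Sum>x\<in>S. k x) = real (card S) - real m - 1"
    proof -
      have "(\<Sum>x\<in>?Fr l. c x * f x m) = 0" using c by simp
      then have "(\<Sum>x\<in>?Fr l. c x) = 0" by (simp add: f_def)
      then show ?thesis using ksum[of "\<lambda>_. 1"] l by simp
    qed
    have s2: "(\<Sum>x\<in>S. k x * u x j) = 0" if "j < m" for j
    proof -
      have "(\<Sum>x\<in>?Fr l. c x * f x j) = 0" using c that by simp
      then have "(\<Sum>x\<in>?Fr l. c x * u x j) = 0" using that by (simp add: f_def)
      then show ?thesis using ksum[of "\<lambda>x. u x j"] l that by simp
    qed
    have "k x0 = 0 \<or> k x0 = 1"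
      using x0 by (auto simp: k_def C_def \<tau>_def)
    then have "?Fr k \<subseteq> ?Fr l - {x0}" by (auto simp: k_def)
    then have "card (?Fr k) \<le> card (?Fr l - {x0})" using finF by (intro card_mono) auto
    also have "\<dots> < card (?Fr l)" using finF x0(1) by (intro card_Diff1_less) (auto simp: C_def)
    finally have "card (?Fr k) < card (?Fr l)" .
    moreover have "card (?Fr l) \<le> card (?Fr k)" using range s1 s2 by (intro least) auto
    ultimately show False by simp
  qed
  then show ?thesis using l by blast
qed

text \<open>Scaling the damping factors lowers their total by one. Some factor may then be assumed
  to be 0, and dropping its element leaves the total required for one element fewer.\<close>

lemma balanced_remove:
  assumes fin: "finite S" and "balanced m u S" and "m < card S"
  shows "\<exists>x\<in>S. balanced m u (S - {x})"
proof -
  obtain l where l: "\<forall>x\<in>S. 0 \<le> l x \<and> l x \<le> 1" "(\<Sum>x\<in>S. l x) = real (card S) - real m"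
     "\<forall>j<m. (\<Sum>x\<in>S. l x * u x j) = 0" using assms unfolding balanced_def by blast
  define s where "s = (real (card S) - real m - 1) / (real (card S) - real m)"
  have s: "0 \<le> s" "s \<le> 1" "s * (real (card S) - real m) = real (card S) - real m - 1"
    using assms(3) by (auto simp: s_def field_simps)
  have "\<exists>l. (\<forall>x\<in>S. 0 \<le> l x \<and> l x \<le> 1) \<and> (\<Sum>x\<in>S. l x) = real (card S) - real m - 1 \<and>
     (\<forall>j<m. (\<Sum>x\<in>S. l x * u x j) = 0)"
    using l s by (intro exI[of _ "\<lambda>x. s * l x"])
      (auto simp: mult_le_one sum_distrib_left[symmetric] mult.assoc)
  from vanishing_coordinate[OF fin this] obtain k x where
    k: "\<forall>x\<in>S. 0 \<le> k x \<and> k x \<le> 1" "(\<Sum>x\<in>S. k x) = real (card S) - real m - 1"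
     "\<forall>j<m. (\<Sum>x\<in>S. k x * u x j) = 0" and x: "x \<in> S" "k x = 0" by blast
  have "(\<Sum>y\<in>S - {x}. k y * g y) = (\<Sum>y\<in>S. k y * g y)" for g :: "_ \<Rightarrow> real"
    using fin x by (simp add: sum.remove[of S x])
  from this[of "\<lambda>_. 1"] this[of "\<lambda>y. u y _"] have "balanced m u (S - {x})"
    unfolding balanced_def using k x fin assms(3)
    by (intro exI[of _ k]) (auto simp: of_nat_diff)
  then show ?thesis using x by blast
qed

text \<open>\<open>C k\<close> holds the first \<open>k\<close> elements removed, that is, the last
  \<open>k\<close> of the Steinitz order. The size hypothesis leaves more than \<open>m\<close>
  elements before each removal.\<close>

lemma balanced_chain:
  assumes "finite S" and "balanced m u S" and "m + r \<le> card S"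
  shows "\<exists>C. C 0 = {} \<and> (\<forall>k\<le>r. C k \<subseteq> S \<and> card (C k) = k \<and> balanced m u (S - C k)) \<and>
    (\<forall>i j. i \<le> j \<longrightarrow> j \<le> r \<longrightarrow> C i \<subseteq> C j)"
  using assms(3)
proof (induction r)
  case 0
  then show ?case using assms by (intro exI[of _ "\<lambda>_. {}"]) auto
next
  case (Suc r)
  then obtain C where C: "C 0 = {}" "\<forall>k\<le>r. C k \<subseteq> S \<and> card (C k) = k \<and> balanced m u (S - C k)"
    "\<forall>i j. i \<le> j \<longrightarrow> j \<le> r \<longrightarrow> C i \<subseteq> C j" by auto
  have Cr: "C r \<subseteq> S" "card (C r) = r" "balanced m u (S - C r)" using C(2) by auto
  have finC: "finite (C r)" using Cr(1) assms(1) finite_subset by blast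
  have "m < card (S - C r)"
    using Suc.prems Cr assms(1) finC by (simp add: card_Diff_subset)
  then obtain x where x: "x \<in> S - C r" "balanced m u (S - C r - {x})"
    using balanced_remove[of "S - C r" m u] Cr assms(1) by auto
  have eq: "S - C r - {x} = S - insert x (C r)" by blast
  define C' where "C' = C(Suc r := insert x (C r))"
  have "C' 0 = {}" using C by (simp add: C'_def)
  moreover have "C' k \<subseteq> S \<and> card (C' k) = k \<and> balanced m u (S - C' k)" if "k \<le> Suc r" for k
    using that C(2) Cr x eq finC by (cases "k = Suc r") (auto simp: C'_def)
  moreover have "C' i \<subseteq> C' j" if "i \<le> j" "j \<le> Suc r" for i j
  proof (cases "j = Suc r")
    case True
    show ?thesis
    proof (cases "i = Suc r")
      case False
      then have "C i \<subseteq> C r" using that True C(3) by auto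
      then show ?thesis using False True by (auto simp: C'_def)
    qed (use True in simp)
  next
    case False
    then show ?thesis using that C(3) by (auto simp: C'_def)
  qed
  ultimately show ?case by blast
qed

lemma balanced_sum_bound:
  assumes "finite S" and "balanced m u S" and "\<forall>x\<in>S. \<bar>u x j\<bar> \<le> d" and "j < m"
  shows "\<bar>\<Sum>x\<in>S. u x j\<bar> \<le> real m * d"
proof -
  obtain l where l: "\<forall>x\<in>S. 0 \<le> l x \<and> l x \<le> 1" "(\<Sum>x\<in>S. l x) = real (card S) - real m"
     "\<forall>j<m. (\<Sum>x\<in>S. l x * u x j) = 0" using assms unfolding balanced_def by blast
  \<comment> \<open>Since the damped vectors cancel, only the weights \<open>1 - l x\<close> remain,
    and their total is \<open>m\<close>.\<close>
  have "(\<Sum>x\<in>S. u x j) = (\<Sum>x\<in>S. (1 - l x) * u x j)"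
    using l(3) assms(4) by (simp add: algebra_simps sum_subtractf)
  also have "\<bar>\<dots>\<bar> \<le> (\<Sum>x\<in>S. \<bar>(1 - l x) * u x j\<bar>)" by (rule sum_abs)
  also have "\<dots> \<le> (\<Sum>x\<in>S. (1 - l x) * d)"
    using l(1) assms(3) by (intro sum_mono) (auto simp: abs_mult intro!: mult_left_mono)
  also have "\<dots> = real m * d"
    using l(2) by (simp add: sum_distrib_right[symmetric] sum_subtractf)
  finally show ?thesis .
qed

lemma card_bounded_int_vectors:
  fixes b :: nat
  shows "finite {xs. set xs \<subseteq> {-int b..int b} \<and> length xs = m}"
    and "card {xs. set xs \<subseteq> {-int b..int b} \<and> length xs = m} = (2 * b + 1) ^ m"
proof -
  show "finite {xs. set xs \<subseteq> {-int b..int b} \<and> length xs = m}"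
    by (rule finite_lists_length_eq) simp
  have "nat (int b + int b + 1) = 2 * b + 1" by linarith
  then show "card {xs. set xs \<subseteq> {-int b..int b} \<and> length xs = m} = (2 * b + 1) ^ m"
    by (subst card_lists_length_eq) (auto simp: algebra_simps)
qed

text \<open>Subtracting the mean makes the vectors cancel. Along a Steinitz order the last \<open>\<rho> + 1\<close>
  tail sums then stay in a box with \<open>\<rho>\<close> integer points, and two equal tail sums differ by a
  zero-sum set.\<close>

lemma zero_sum_subset:
  fixes v :: "'b \<Rightarrow> nat \<Rightarrow> int" and d m :: nat
  defines "\<rho> \<equiv> (2 * m * d + 3) ^ m"
  assumes fin: "finite I" and bound: "\<forall>x\<in>I. \<forall>j<m. \<bar>v x j\<bar> \<le> int d"
    and large: "\<rho> + m \<le> card I"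
    and small: "\<forall>j<m. int \<rho> * \<bar>\<Sum>x\<in>I. v x j\<bar> \<le> int (card I)"
  shows "\<exists>J\<subseteq>I. J \<noteq> {} \<and> card J \<le> \<rho> \<and> (\<forall>j<m. (\<Sum>x\<in>J. v x j) = 0)"
proof -
  let ?n = "real (card I)"
  have \<rho>m: "m < \<rho>" and \<rho>1: "1 \<le> \<rho>"
  proof -
    have "m < 2 ^ m" by (rule less_exp)
    also have "(2::nat) ^ m \<le> \<rho>" unfolding \<rho>_def by (intro power_mono) auto
    finally show "m < \<rho>" .
    then show "1 \<le> \<rho>" by simp
  qed
  have n0: "?n > 0" using large \<rho>1 by simp
  \<comment> \<open>\<open>h\<close> is the mean. The hypothesis \<open>small\<close> bounds it by
    \<open>1 / \<rho>\<close>, so centring changes a sum of at most \<open>\<rho>\<close> vectors by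
    at most 1.\<close>
  define h where "h = (\<lambda>j. real_of_int (\<Sum>x\<in>I. v x j) / ?n)"
  define u where "u = (\<lambda>x j. real_of_int (v x j) - h j)"
  have hb: "real \<rho> * \<bar>h j\<bar> \<le> 1" if "j < m" for j
  proof -
    have "real_of_int (int \<rho> * \<bar>\<Sum>x\<in>I. v x j\<bar>) \<le> real_of_int (int (card I))"
      using small that by (simp only: of_int_le_iff)
    then show ?thesis using n0 by (simp add: h_def abs_divide field_simps)
  qed
  have usum: "(\<Sum>x\<in>I. u x j) = 0" for j
    using n0 by (simp add: u_def sum_subtractf h_def)
  have "balanced m u I"
  proof -
    \<comment> \<open>Uniform damping works at the start because the centred vectors cancel over
      \<open>I\<close>.\<close>
    have "(\<Sum>x\<in>I. (?n - real m) / ?n) = ?n - real m" using n0 by simp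
    moreover have "(\<Sum>x\<in>I. (?n - real m) / ?n * u x j) = 0" for j
      using usum[of j] by (metis mult_zero_right sum_distrib_left)
    moreover have "0 \<le> (?n - real m) / ?n" "(?n - real m) / ?n \<le> 1"
      using n0 large by (auto simp: field_simps)
    ultimately show ?thesis
      unfolding balanced_def by (intro exI[of _ "\<lambda>_. (?n - real m) / ?n"]) simp
  qed
  moreover have "m + \<rho> \<le> card I" using large by simp
  ultimately obtain C where C: "C 0 = {}"
    "\<forall>k\<le>\<rho>. C k \<subseteq> I \<and> card (C k) = k \<and> balanced m u (I - C k)"
    "\<forall>i j. i \<le> j \<longrightarrow> j \<le> \<rho> \<longrightarrow> C i \<subseteq> C j"
    using balanced_chain[OF fin, of m u \<rho>] by blast
  have ub: "\<bar>u x j\<bar> \<le> real d + 1 / real \<rho>" if "x \<in> I" "j < m" for x j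
  proof -
    have "\<bar>real_of_int (v x j)\<bar> \<le> real d"
      using bound that by (metis of_int_abs of_int_le_iff of_int_of_nat_eq)
    moreover have "\<bar>h j\<bar> \<le> 1 / real \<rho>" using hb[OF that(2)] \<rho>1 by (simp add: field_simps)
    ultimately show ?thesis unfolding u_def by linarith
  qed
  \<comment> \<open>The \<open>u\<close>-sum over \<open>C k\<close> is minus the one over
    \<open>I - C k\<close>, which is below \<open>m * d + 1\<close> in absolute value because
    \<open>m < \<rho>\<close>. Undoing the centring costs at most 1, and integrality sharpens
    \<open>< m * d + 2\<close> to \<open>\<le> m * d + 1\<close>.\<close>
  have tail: "\<bar>\<Sum>x\<in>C k. v x j\<bar> \<le> int (m * d + 1)" if "k \<le> \<rho>" "j < m" for k j
  proof -
    have Ck: "C k \<subseteq> I" "card (C k) = k" "balanced m u (I - C k)" using C(2) that by auto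
    have "\<bar>\<Sum>x\<in>I - C k. u x j\<bar> \<le> real m * (real d + 1 / real \<rho>)"
      using ub that fin by (intro balanced_sum_bound[OF _ Ck(3)]) auto
    moreover have "(\<Sum>x\<in>I - C k. u x j) + (\<Sum>x\<in>C k. u x j) = (\<Sum>x\<in>I. u x j)"
      using fin Ck(1) by (simp add: sum.subset_diff[of "C k" I])
    moreover have "(\<Sum>x\<in>C k. u x j) = real_of_int (\<Sum>x\<in>C k. v x j) - real k * h j"
      by (simp add: u_def sum_subtractf Ck(2))
    moreover have "\<bar>real k * h j\<bar> \<le> 1"
      using hb[OF that(2)] mult_right_mono[of "real k" "real \<rho>" "\<bar>h j\<bar>"] that
      by (simp add: abs_mult)
    moreover have "real m * (real d + 1 / real \<rho>) < real m * real d + 1"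
      using \<rho>m by (simp add: distrib_left)
    ultimately have "\<bar>real_of_int (\<Sum>x\<in>C k. v x j)\<bar> < real m * real d + 2"
      using usum[of j] by linarith
    then have "real_of_int \<bar>\<Sum>x\<in>C k. v x j\<bar> < real_of_int (int (m * d + 2))" by simp
    then show ?thesis unfolding of_int_less_iff by simp
  qed
  define T where "T = (\<lambda>k. map (\<lambda>j. \<Sum>x\<in>C k. v x j) [0..<m])"
  let ?L = "{xs. set xs \<subseteq> {-int (m * d + 1)..int (m * d + 1)} \<and> length xs = m}"
  have "T ` {..\<rho>} \<subseteq> ?L"
  proof
    fix xs assume "xs \<in> T ` {..\<rho>}"
    then obtain k where k: "k \<le> \<rho>" "xs = T k" by auto
    have "- int (m * d + 1) \<le> (\<Sum>x\<in>C k. v x j) \<and> (\<Sum>x\<in>C k. v x j) \<le> int (m * d + 1)"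
      if "j < m" for j using tail[OF k(1) that] by linarith
    then show "xs \<in> ?L" using k by (auto simp: T_def)
  qed
  then have "card (T ` {..\<rho>}) \<le> card ?L" by (intro card_mono card_bounded_int_vectors(1))
  also have "\<dots> = (2 * (m * d + 1) + 1) ^ m" by (rule card_bounded_int_vectors(2))
  \<comment> \<open>The side of the box explains the base \<open>2 * m * d + 3\<close> of
    \<open>\<rho>\<close>.\<close>
  also have "2 * (m * d + 1) + 1 = 2 * m * d + 3" by simp
  also have "(2 * m * d + 3) ^ m = \<rho>" by (simp only: \<rho>_def)
  also have "\<rho> < card {..\<rho>}" by simp
  finally have "\<not> inj_on T {..\<rho>}" using pigeonhole by blast
  then obtain i j where "i \<le> \<rho>" "j \<le> \<rho>" "i \<noteq> j" "T i = T j" by (auto simp: inj_on_def)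
  then obtain i j where ij: "i < j" "j \<le> \<rho>" "T i = T j" by (metis nat_neq_iff)
  have sub: "C i \<subseteq> C j" "C j \<subseteq> I" "card (C i) = i" "card (C j) = j"
    using C ij by auto
  have finCj: "finite (C j)" using sub fin finite_subset by blast
  have finCi: "finite (C i)" using sub finCj finite_subset by blast
  have "card (C j - C i) = j - i" using sub finCi by (simp add: card_Diff_subset)
  then have "C j - C i \<noteq> {}" "card (C j - C i) \<le> \<rho>" using ij by force+
  moreover have "(\<Sum>x\<in>C j - C i. v x l) = 0" if "l < m" for l
  proof -
    have "T i ! l = T j ! l" using ij by simp
    then have "(\<Sum>x\<in>C i. v x l) = (\<Sum>x\<in>C j. v x l)" using that by (simp add: T_def)
    then show ?thesis using sub finCj by (simp add: sum_diff)
  qed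
  ultimately show ?thesis using sub by (intro exI[of _ "C j - C i"]) auto
qed

section \<open>Rank and Rado's theorem\<close>

definition rank :: "('a set \<Rightarrow> bool) \<Rightarrow> 'a set \<Rightarrow> nat" where
  "rank indep X = Max (card ` {Y. indep Y \<and> Y \<subseteq> X})"

context
  fixes E :: "'a set" and indep :: "'a set \<Rightarrow> bool"
  assumes M: "matroid E indep"
begin

lemma finite_E: "finite E"
  and indep_subset_E: "indep X \<Longrightarrow> X \<subseteq> E"
  and indep_empty: "indep {}"
  and indep_mono: "indep X \<Longrightarrow> Y \<subseteq> X \<Longrightarrow> indep Y"
  and augment: "indep X \<Longrightarrow> indep Y \<Longrightarrow> card X < card Y \<Longrightarrow> \<exists>e\<in>Y - X. indep (insert e X)"
  using M unfolding matroid_def by blast+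

lemma indep_finite: "indep X \<Longrightarrow> finite X"
  using indep_subset_E finite_E finite_subset by blast

lemma finite_indep_subsets: "finite (card ` {Y. indep Y \<and> Y \<subseteq> X})"
  by (rule finite_imageI, rule finite_subset[of _ "Pow E"]) (use indep_subset_E finite_E in auto)

lemma card_le_rank: "indep Y \<Longrightarrow> Y \<subseteq> X \<Longrightarrow> card Y \<le> rank indep X"
  unfolding rank_def using finite_indep_subsets by (intro Max_ge) auto

lemma rank_witness: obtains Y where "indep Y" "Y \<subseteq> X" "card Y = rank indep X"
proof -
  have "rank indep X \<in> card ` {Y. indep Y \<and> Y \<subseteq> X}"
    unfolding rank_def using finite_indep_subsets indep_empty by (intro Max_in) auto
  then show ?thesis using that by auto
qed

lemma extend_to_rank:
  assumes "indep X" "X \<subseteq> Y"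
  obtains Z where "indep Z" "X \<subseteq> Z" "Z \<subseteq> Y" "card Z = rank indep Y"
proof -
  have "\<exists>Z. indep Z \<and> X \<subseteq> Z \<and> Z \<subseteq> Y \<and> card Z = rank indep Y"
    using assms
  proof (induction "rank indep Y - card X" arbitrary: X rule: less_induct)
    case less
    show ?case
    proof (cases "card X < rank indep Y")
      case True
      obtain R where R: "indep R" "R \<subseteq> Y" "card R = rank indep Y" by (rule rank_witness)
      obtain e where e: "e \<in> R - X" "indep (insert e X)" using augment less.prems R True by metis
      have "card (insert e X) = Suc (card X)" using e less.prems indep_finite by auto
      then have "\<exists>Z. indep Z \<and> insert e X \<subseteq> Z \<and> Z \<subseteq> Y \<and> card Z = rank indep Y"
        using True e R less.prems by (intro less.hyps) auto
      then show ?thesis by blast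
    next
      case False
      then show ?thesis using less.prems card_le_rank by (metis le_antisym not_less order_refl)
    qed
  qed
  then show ?thesis using that by blast
qed

lemma rank_mono: "X \<subseteq> Y \<Longrightarrow> rank indep X \<le> rank indep Y"
  by (metis rank_witness card_le_rank order_trans)

lemma rank_le_card: "finite X \<Longrightarrow> rank indep X \<le> card X"
  by (metis rank_witness card_mono)

lemma indep_if_rank: "finite X \<Longrightarrow> card X \<le> rank indep X \<Longrightarrow> indep X"
  by (metis rank_witness card_seteq)

text \<open>Extend a largest independent subset of the intersection to one of the union,
  \<open>J\<close>, and count \<open>J\<close> inside \<open>X\<close> and inside \<open>Y\<close>:
  the overlap is counted twice.\<close>

lemma rank_submodular:
  "rank indep (X \<union> Y) + rank indep (X \<inter> Y) \<le> rank indep X + rank indep Y"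
proof -
  obtain I where I: "indep I" "I \<subseteq> X \<inter> Y" "card I = rank indep (X \<inter> Y)" by (rule rank_witness)
  then obtain J where J: "indep J" "I \<subseteq> J" "J \<subseteq> X \<union> Y" "card J = rank indep (X \<union> Y)"
    by (metis extend_to_rank le_infE le_supI1)
  have fin: "finite J" using J indep_finite by blast
  have "card I \<le> card (J \<inter> X \<inter> Y)" using I J fin by (intro card_mono) auto
  moreover have "card (J \<inter> X) + card (J \<inter> Y) = card (J \<inter> X \<union> J \<inter> Y) + card (J \<inter> X \<inter> (J \<inter> Y))"
    using fin by (intro card_Un_Int) auto
  moreover have "J \<inter> X \<union> J \<inter> Y = J" "J \<inter> X \<inter> (J \<inter> Y) = J \<inter> X \<inter> Y" using J by auto
  moreover have "card (J \<inter> X) \<le> rank indep X" "card (J \<inter> Y) \<le> rank indep Y"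
    using J indep_mono by (auto intro!: card_le_rank)
  ultimately show ?thesis using I J by simp
qed

lemma basis_card_eq:
  assumes "basis indep A" "basis indep B" shows "card A = card B"
proof -
  have "\<not> card X < card Y" if "basis indep X" "basis indep Y" for X Y
    using augment[of X Y] that unfolding basis_def by blast
  then show ?thesis using assms by (meson nat_neq_iff)
qed

lemma basis_if_card:
  assumes "basis indep A" "indep X" "card X = card A" shows "basis indep X"
  unfolding basis_def
proof (intro conjI allI impI)
  show "indep X" by fact
  fix Y assume Y: "indep Y \<and> X \<subseteq> Y"
  have "card Y \<le> card A"
    using augment[of A Y] assms(1) Y unfolding basis_def by (metis DiffE insertI1 not_le subset_insertI)
  then show "Y = X" using Y assms(3) indep_finite card_seteq by metis
qed

text \<open>Induction on the total size of the family: submodularity shows that of two elements of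
  a set \<open>F x\<close> at least one can be deleted.\<close>

theorem rado:
  assumes "finite L" "\<forall>x\<in>L. finite (F x)"
    and "\<forall>K\<subseteq>L. card K \<le> rank indep (\<Union>x\<in>K. F x)"
  shows "\<exists>\<phi>. inj_on \<phi> L \<and> (\<forall>x\<in>L. \<phi> x \<in> F x) \<and> indep (\<phi> ` L)"
  using assms
proof (induction "\<Sum>x\<in>L. card (F x)" arbitrary: F rule: less_induct)
  case less
  have ne: "F x \<noteq> {}" if "x \<in> L" for x
  proof
    assume "F x = {}"
    then show False using less.prems(3) that rank_le_card[of "{}"] by (auto dest!: spec[of _ "{x}"])
  qed
  show ?case
  proof (cases "\<forall>x\<in>L. \<forall>a\<in>F x. \<forall>b\<in>F x. a = b")
    case True
    define \<phi> where "\<phi> = (\<lambda>x. SOME a. a \<in> F x)"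
    have \<phi>: "\<phi> x \<in> F x" if "x \<in> L" for x using ne[OF that] by (simp add: \<phi>_def some_in_eq)
    then have "(\<Union>x\<in>L. F x) = \<phi> ` L" using True by blast
    \<comment> \<open>With singletons only, the condition for \<open>L\<close> itself forces
      \<open>\<phi>\<close> to be injective with independent image.\<close>
    then have r: "card L \<le> rank indep (\<phi> ` L)" using less.prems(3) by auto
    moreover have "rank indep (\<phi> ` L) \<le> card (\<phi> ` L)" using less.prems(1) by (simp add: rank_le_card)
    moreover have "card (\<phi> ` L) \<le> card L" using less.prems(1) by (simp add: card_image_le)
    ultimately have "inj_on \<phi> L" "indep (\<phi> ` L)"
      using less.prems(1) by (auto intro: eq_card_imp_inj_on indep_if_rank)
    then show ?thesis using \<phi> by blast
  next
    case False
    then obtain x a b where x: "x \<in> L" "a \<in> F x" "b \<in> F x" "a \<noteq> b" by blast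
    define G where "G = (\<lambda>c. F(x := F x - {c}))"
    have smaller: "(\<Sum>y\<in>L. card (G c y)) < (\<Sum>y\<in>L. card (F y))" if "c \<in> F x" for c
    proof (rule sum_strict_mono_ex1)
      show "\<forall>y\<in>L. card (G c y) \<le> card (F y)"
        using less.prems(2) by (auto simp: G_def card_Diff1_le)
      have "card (F x - {c}) < card (F x)"
        using less.prems(2) x that by (intro card_Diff1_less) auto
      then show "\<exists>y\<in>L. card (G c y) < card (F y)"
        using x by (intro bexI[of _ x]) (auto simp: G_def)
    qed (rule less.prems(1))
    have finG: "\<forall>y\<in>L. finite (G c y)" for c using less.prems(2) x by (auto simp: G_def)
    show ?thesis
    proof (cases "\<exists>c\<in>{a,b}. \<forall>K\<subseteq>L. card K \<le> rank indep (\<Union>y\<in>K. G c y)")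
      case True
      then obtain c where c: "c \<in> F x" "\<forall>K\<subseteq>L. card K \<le> rank indep (\<Union>y\<in>K. G c y)" using x by auto
      from less.hyps[OF smaller[OF c(1)] less.prems(1) finG c(2)] obtain \<phi> where
        "inj_on \<phi> L" "\<forall>y\<in>L. \<phi> y \<in> G c y" "indep (\<phi> ` L)" by blast
      moreover have "G c y \<subseteq> F y" for y by (auto simp: G_def)
      ultimately show ?thesis by blast
    next
      case False
      \<comment> \<open>Deleting \<open>c\<close> affects only \<open>F x\<close>, so a violating
        family must contain \<open>x\<close>; it is recorded without \<open>x\<close>, which turns
        the strict inequality into a weak one.\<close>
      have obstruction: "\<exists>K\<subseteq>L - {x}. rank indep ((\<Union>y\<in>K. F y) \<union> (F x - {c})) \<le> card K"
        if c: "c \<in> {a,b}" for c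
      proof -
        obtain K where K: "K \<subseteq> L" "rank indep (\<Union>y\<in>K. G c y) < card K"
          using False c by (auto simp: not_le)
        have "x \<in> K"
        proof (rule ccontr)
          assume "x \<notin> K"
          then have "(\<Union>y\<in>K. G c y) = (\<Union>y\<in>K. F y)" by (auto simp: G_def)
          then show False using K less.prems(3) by (metis leD)
        qed
        then have "(\<Union>y\<in>K. G c y) = (\<Union>y\<in>K - {x}. F y) \<union> (F x - {c})" by (auto simp: G_def)
        moreover have "card K = Suc (card (K - {x}))"
          using \<open>x \<in> K\<close> K(1) less.prems(1) by (metis card.remove finite_subset)
        ultimately show ?thesis using K by (intro exI[of _ "K - {x}"]) auto
      qed
      obtain K1 where K1: "K1 \<subseteq> L - {x}" "rank indep ((\<Union>y\<in>K1. F y) \<union> (F x - {a})) \<le> card K1"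
        using obstruction[of a] by blast
      obtain K2 where K2: "K2 \<subseteq> L - {x}" "rank indep ((\<Union>y\<in>K2. F y) \<union> (F x - {b})) \<le> card K2"
        using obstruction[of b] by blast
      let ?U1 = "(\<Union>y\<in>K1. F y) \<union> (F x - {a})" and ?U2 = "(\<Union>y\<in>K2. F y) \<union> (F x - {b})"
      have fin: "finite K1" "finite K2" using K1 K2 less.prems(1) finite_subset by blast+
      \<comment> \<open>Because \<open>a \<noteq> b\<close>, the union regains all of
        \<open>F x\<close>. Hence \<open>x\<close> counts on the union side, and submodularity is
        violated by one.\<close>
      have "?U1 \<union> ?U2 = (\<Union>y\<in>insert x (K1 \<union> K2). F y)" using x by blast
      moreover have "card (insert x (K1 \<union> K2)) \<le> rank indep (\<Union>y\<in>insert x (K1 \<union> K2). F y)"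
        by (rule less.prems(3)[rule_format]) (use K1(1) K2(1) x(1) in blast)
      moreover have "card (insert x (K1 \<union> K2)) = Suc (card (K1 \<union> K2))"
        using fin K1(1) K2(1) by (subst card_insert_disjoint) auto
      ultimately have "Suc (card (K1 \<union> K2)) \<le> rank indep (?U1 \<union> ?U2)" by (simp only:)
      moreover have "card (K1 \<inter> K2) \<le> rank indep (?U1 \<inter> ?U2)"
      proof -
        have "card (K1 \<inter> K2) \<le> rank indep (\<Union>y\<in>K1 \<inter> K2. F y)"
          by (rule less.prems(3)[rule_format]) (use K1(1) in blast)
        also have "\<dots> \<le> rank indep (?U1 \<inter> ?U2)" by (intro rank_mono) blast
        finally show ?thesis .
      qed
      moreover have "card K1 + card K2 = card (K1 \<union> K2) + card (K1 \<inter> K2)"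
        using fin by (rule card_Un_Int)
      ultimately show ?thesis using rank_submodular[of ?U1 ?U2] K1(2) K2(2) by linarith
    qed
  qed
qed

end

text \<open>In this matroid the rank of a subset of \<open>U\<close> is its size, so Rado's theorem
  specialises to Hall's.\<close>

lemma matroid_free: "finite U \<Longrightarrow> matroid U (\<lambda>X. X \<subseteq> U)"
  unfolding matroid_def
proof (intro conjI allI impI)
  fix X Y assume "finite U" "X \<subseteq> U \<and> Y \<subseteq> U \<and> card X < card Y"
  then have "\<not> Y \<subseteq> X" by (metis card_mono finite_subset leD)
  then show "\<exists>e\<in>Y - X. insert e X \<subseteq> U"
    using \<open>X \<subseteq> U \<and> Y \<subseteq> U \<and> card X < card Y\<close> by blast
qed auto

text \<open>The defect is absorbed by \<open>\<delta>\<close> dummy elements adjacent to everything.\<close>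

lemma hall_defect:
  fixes R :: "'b \<Rightarrow> 'c \<Rightarrow> bool"
  assumes fin: "finite L" "finite Y"
    and hall: "\<And>K. K \<subseteq> L \<Longrightarrow> card K \<le> card {y\<in>Y. \<exists>x\<in>K. R x y} + \<delta>"
  shows "\<exists>L0 \<phi>. L0 \<subseteq> L \<and> card L \<le> card L0 + \<delta> \<and> inj_on \<phi> L0 \<and> (\<forall>x\<in>L0. \<phi> x \<in> Y \<and> R x (\<phi> x))"
proof -
  define U where "U = (Inl ` Y \<union> Inr ` {..<\<delta>} :: ('c + nat) set)"
  have finU: "finite U" using fin by (simp add: U_def)
  note Mf = matroid_free[OF finU]
  define F where "F = (\<lambda>x. Inl ` {y\<in>Y. R x y} \<union> Inr ` {..<\<delta>} :: ('c + nat) set)"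
  have FU: "F x \<subseteq> U" for x by (auto simp: F_def U_def)
  have "card K \<le> rank (\<lambda>X. X \<subseteq> U) (\<Union>x\<in>K. F x)" if K: "K \<subseteq> L" for K
  proof (cases "K = {}")
    case False
    have "(\<Union>x\<in>K. F x) = Inl ` {y\<in>Y. \<exists>x\<in>K. R x y} \<union> Inr ` {..<\<delta>}"
      using False by (auto simp: F_def)
    moreover have "card (Inl ` {y\<in>Y. \<exists>x\<in>K. R x y} \<union> Inr ` {..<\<delta>} :: ('c + nat) set)
        = card {y\<in>Y. \<exists>x\<in>K. R x y} + \<delta>"
      using fin by (subst card_Un_disjoint) (auto simp: card_image)
    ultimately have "card K \<le> card (\<Union>x\<in>K. F x)" using hall[OF K] by simp
    also have "\<dots> \<le> rank (\<lambda>X. X \<subseteq> U) (\<Union>x\<in>K. F x)"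
      using FU by (intro card_le_rank[OF Mf]) auto
    finally show ?thesis .
  qed simp
  moreover have "\<forall>x\<in>L. finite (F x)" using FU finU finite_subset by blast
  ultimately obtain \<phi> where \<phi>: "inj_on \<phi> L" "\<forall>x\<in>L. \<phi> x \<in> F x"
    using rado[OF Mf fin(1), of F] by blast
  \<comment> \<open>\<open>L0\<close> holds the elements with a genuine partner; the others are sent
    injectively to the \<open>\<delta>\<close> dummies.\<close>
  define L0 where "L0 = {x\<in>L. \<phi> x \<in> range Inl}"
  have L0: "\<exists>y\<in>Y. R x y \<and> \<phi> x = Inl y" if "x \<in> L0" for x
    using that \<phi>(2) by (auto simp: L0_def F_def)
  have "\<phi> ` (L - L0) \<subseteq> Inr ` {..<\<delta>}" using \<phi>(2) by (auto simp: L0_def F_def)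
  then have "card (\<phi> ` (L - L0)) \<le> card (Inr ` {..<\<delta>} :: ('c + nat) set)" by (intro card_mono) auto
  also have "\<dots> = \<delta>" by (simp add: card_image)
  also have "card (\<phi> ` (L - L0)) = card (L - L0)"
    using \<phi>(1) by (intro card_image) (auto intro: inj_on_subset)
  also have "card (L - L0) = card L - card L0"
    using fin by (intro card_Diff_subset) (auto simp: L0_def)
  finally have "card L \<le> card L0 + \<delta>" by simp
  moreover have "L0 \<subseteq> L" by (auto simp: L0_def)
  moreover obtain \<psi> where \<psi>: "\<forall>x\<in>L0. \<psi> x \<in> Y \<and> R x (\<psi> x) \<and> \<phi> x = Inl (\<psi> x)"
    using bchoice[of L0 "\<lambda>x y. y \<in> Y \<and> R x y \<and> \<phi> x = Inl y"] L0 by blast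
  moreover have "inj_on \<psi> L0"
  proof (rule inj_onI)
    fix x y assume "x \<in> L0" "y \<in> L0" "\<psi> x = \<psi> y"
    then show "x = y" using \<phi>(1) \<psi> \<open>L0 \<subseteq> L\<close> by (metis inj_onD subsetD)
  qed
  ultimately show ?thesis by blast
qed

section \<open>Exchanging whole classes\<close>

lemma submodular_Int_INT_le:
  fixes s :: "'a set \<Rightarrow> int"
  assumes "\<And>X Y. s (X \<union> Y) + s (X \<inter> Y) \<le> s X + s Y" and "\<And>X. 0 \<le> s X" and "finite Q"
  shows "s (U \<inter> (\<Inter>q\<in>Q. Z q)) \<le> s U + (\<Sum>q\<in>Q. s (Z q))"
  using assms(3)
proof induction
  case (insert q Q)
  have "U \<inter> (\<Inter>q\<in>insert q Q. Z q) = Z q \<inter> (U \<inter> (\<Inter>q\<in>Q. Z q))" by auto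
  then show ?case
    using insert assms(1)[of "Z q" "U \<inter> (\<Inter>q\<in>Q. Z q)"] assms(2)[of "Z q \<union> (U \<inter> (\<Inter>q\<in>Q. Z q))"]
    by simp
qed simp

text \<open>The dual estimate: here the term for the intersection is dropped.\<close>

lemma submodular_UN_le:
  fixes s :: "'a set \<Rightarrow> int"
  assumes "\<And>X Y. s (X \<union> Y) + s (X \<inter> Y) \<le> s X + s Y" and "\<And>X. 0 \<le> s X" and "finite Q"
  shows "s (\<Union>q\<in>Q. Z q) \<le> s {} + (\<Sum>q\<in>Q. s (Z q))"
  using assms(3)
proof induction
  case (insert q Q)
  then show ?case
    using assms(1)[of "Z q" "\<Union>q\<in>Q. Z q"] assms(2)[of "Z q \<inter> (\<Union>q\<in>Q. Z q)"]
    by simp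
qed simp

definition class_closed :: "('a \<Rightarrow> 'k) \<Rightarrow> 'a set \<Rightarrow> 'a set \<Rightarrow> bool" where
  "class_closed key U Z \<longleftrightarrow> Z \<subseteq> U \<and> (\<forall>x\<in>Z. \<forall>y\<in>U. key y = key x \<longrightarrow> y \<in> Z)"

text \<open>The amount \<open>\<rho>\<close> by which \<open>f\<close> can be exchanged for \<open>e\<close> when only the number of elements in
  each class matters. Exchanges of capacity \<open>\<rho>\<close> can be combined freely as long as their total
  number is at most \<open>\<rho>\<close>.\<close>

definition exchangeable ::
    "('a set \<Rightarrow> bool) \<Rightarrow> ('a \<Rightarrow> 'k) \<Rightarrow> 'a set \<Rightarrow> 'a set \<Rightarrow> nat \<Rightarrow> 'a \<Rightarrow> 'a \<Rightarrow> bool" where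
  "exchangeable indep key U A \<rho> e f \<longleftrightarrow>
     (\<forall>Z. class_closed key U Z \<longrightarrow> e \<in> Z \<longrightarrow> f \<notin> Z \<longrightarrow> card (A \<inter> Z) + \<rho> \<le> rank indep Z)"

context
  fixes E :: "'a set" and indep :: "'a set \<Rightarrow> bool" and A B :: "'a set" and key :: "'a \<Rightarrow> 'k"
  assumes M: "matroid E indep" and A: "basis indep A" and B: "basis indep B"
begin

lemma finite_A: "finite A" and finite_B: "finite B"
  and indep_A: "indep A" and indep_B: "indep B"
  using A B indep_finite[OF M] unfolding basis_def by auto

lemma card_Int_le_rank: "card (A \<inter> Z) \<le> rank indep Z" "card (B \<inter> Z) \<le> rank indep Z"
  using indep_A indep_B by (auto intro!: card_le_rank[OF M] intro: indep_mono[OF M])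

lemma card_A_Diff_B: "card (A - B) = card (B - A)"
proof -
  have "card (A \<inter> B) + card (A - B) = card (A \<inter> B) + card (B - A)"
    using basis_card_eq[OF M A B] card_Int_Diff[OF finite_A, of B] card_Int_Diff[OF finite_B, of A]
    by (simp add: Int_commute)
  then show ?thesis by simp
qed

lemma rank_le_card_A: "rank indep Z \<le> card A"
proof -
  obtain R where R: "indep R" "card R = rank indep Z" using rank_witness[OF M] by metis
  have "\<not> card A < card R"
    using augment[OF M, of A R] A R unfolding basis_def by (metis DiffE insertI1 subset_insertI)
  then show ?thesis using R by simp
qed

text \<open>If \<open>X\<close> and \<open>Y\<close> are separated pairwise by almost tight sets, uncrossing these sets
  separates all of \<open>X\<close> from all of \<open>Y\<close>.\<close>

lemma card_unexchangeable_le: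
  assumes X: "X \<subseteq> B - A" and Y: "Y \<subseteq> A - B"
    and sep: "\<And>e f. e \<in> X \<Longrightarrow> f \<in> Y \<Longrightarrow> \<not> exchangeable indep key (A \<union> B) A \<rho> e f"
    and K: "card (key ` X) \<le> K" "card (key ` Y) \<le> K"
  shows "card X + card Y \<le> card (A - B) + K * K * \<rho>"
proof -
  define s where "s = (\<lambda>Z. int (rank indep Z) - int (card (A \<inter> Z)))"
  have finXY: "finite X" "finite Y" using X Y finite_A finite_B finite_subset by blast+
  have s_nonneg: "0 \<le> s Z" for Z using card_Int_le_rank by (simp add: s_def)
  have s_sub: "s (Z1 \<union> Z2) + s (Z1 \<inter> Z2) \<le> s Z1 + s Z2" for Z1 Z2
  proof -
    have "card (A \<inter> Z1) + card (A \<inter> Z2) = card (A \<inter> Z1 \<union> A \<inter> Z2) + card (A \<inter> Z1 \<inter> (A \<inter> Z2))"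
      using finite_A by (intro card_Un_Int) auto
    moreover have "A \<inter> Z1 \<union> A \<inter> Z2 = A \<inter> (Z1 \<union> Z2)" "A \<inter> Z1 \<inter> (A \<inter> Z2) = A \<inter> (Z1 \<inter> Z2)" by auto
    ultimately show ?thesis using rank_submodular[OF M, of Z1 Z2] by (simp add: s_def)
  qed
  have s_empty: "s {} = 0" using rank_le_card[OF M, of "{}"] by (simp add: s_def)
  have s_all: "s (A \<union> B) = 0"
    using rank_le_card_A[of "A \<union> B"] s_nonneg[of "A \<union> B"] by (simp add: s_def Int_absorb2)
  \<comment> \<open>A class-closed set separating \<open>e\<close> from \<open>f\<close> separates
    their entire classes within \<open>X\<close> and \<open>Y\<close>. One set per pair of classes
    is therefore enough, whence the factor \<open>K * K\<close>.\<close>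
  define P where "P = (\<lambda>p q Z. (\<forall>x\<in>X. key x = p \<longrightarrow> x \<in> Z) \<and> (\<forall>y\<in>Y. key y = q \<longrightarrow> y \<notin> Z) \<and> s Z \<le> int \<rho>)"
  have "\<exists>Z. P p q Z" if pq: "p \<in> key ` X" "q \<in> key ` Y" for p q
  proof -
    obtain e f where ef: "e \<in> X" "key e = p" "f \<in> Y" "key f = q" using pq by blast
    then obtain Z where Z: "class_closed key (A \<union> B) Z" "e \<in> Z" "f \<notin> Z"
      "rank indep Z < card (A \<inter> Z) + \<rho>"
      using sep unfolding exchangeable_def by (meson not_le)
    have "\<forall>x\<in>X. key x = p \<longrightarrow> x \<in> Z" "\<forall>y\<in>Y. key y = q \<longrightarrow> y \<notin> Z"
      using Z ef X Y unfolding class_closed_def by (metis DiffD1 UnCI subsetD)+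
    then show ?thesis using Z(4) unfolding P_def s_def by (intro exI[of _ Z]) auto
  qed
  then obtain Z where Z: "\<And>p q. p \<in> key ` X \<Longrightarrow> q \<in> key ` Y \<Longrightarrow> P p q (Z p q)" by metis
  \<comment> \<open>For each class of \<open>X\<close>, the intersection excludes all of
    \<open>Y\<close> and retains that class; the union then collects all of \<open>X\<close>.
    Starting from \<open>A \<union> B\<close>, where \<open>s\<close> vanishes, adds no
    cost.\<close>
  define T where "T = (\<Union>p\<in>key ` X. (A \<union> B) \<inter> (\<Inter>q\<in>key ` Y. Z p q))"
  have "s T \<le> s {} + (\<Sum>p\<in>key ` X. s ((A \<union> B) \<inter> (\<Inter>q\<in>key ` Y. Z p q)))"
    unfolding T_def using finXY by (intro submodular_UN_le s_sub s_nonneg) auto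
  also have "\<dots> \<le> s {} + (\<Sum>p\<in>key ` X. s (A \<union> B) + (\<Sum>q\<in>key ` Y. s (Z p q)))"
    using finXY by (intro add_left_mono sum_mono submodular_Int_INT_le s_sub s_nonneg) auto
  also have "\<dots> \<le> (\<Sum>p\<in>key ` X. \<Sum>q\<in>key ` Y. int \<rho>)"
    unfolding s_empty s_all add_0 using Z unfolding P_def by (intro sum_mono) blast
  also have "\<dots> = int (card (key ` X) * card (key ` Y) * \<rho>)" by simp
  also have "\<dots> \<le> int (K * K * \<rho>)"
    using K by (intro zle_int[THEN iffD2] mult_le_mono) auto
  finally have T: "rank indep T \<le> card (A \<inter> T) + K * K * \<rho>" unfolding s_def by linarith
  have XZ: "x \<in> Z (key x) q" if "x \<in> X" "q \<in> key ` Y" for x q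
    using Z[of "key x" q] that unfolding P_def by simp
  have YZ: "y \<notin> Z p (key y)" if "y \<in> Y" "p \<in> key ` X" for y p
    using Z[of p "key y"] that unfolding P_def by simp
  have XT: "X \<subseteq> T"
  proof
    fix x assume x: "x \<in> X"
    then have "x \<in> (A \<union> B) \<inter> (\<Inter>q\<in>key ` Y. Z (key x) q)"
      using XZ[OF x] X by auto
    then show "x \<in> T" using x unfolding T_def by (intro UN_I[of "key x"]) auto
  qed
  have YT: "Y \<inter> T = {}"
  proof -
    have "y \<notin> T" if y: "y \<in> Y" for y
    proof
      assume "y \<in> T"
      then obtain p where p: "p \<in> key ` X" "y \<in> (A \<union> B) \<inter> (\<Inter>q\<in>key ` Y. Z p q)"
        unfolding T_def by (rule UN_E)
      then show False using YZ[OF y p(1)] y by simp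
    qed
    then show ?thesis by auto
  qed
  \<comment> \<open>\<open>B \<inter> T\<close> contains \<open>X\<close> and
    \<open>A \<inter> B \<inter> T\<close>, and its size is at most the rank of the almost tight set
    \<open>T\<close>. Cancelling the common part bounds \<open>card X\<close> by the part of
    \<open>A - B\<close> in \<open>T\<close>, which avoids \<open>Y\<close>.\<close>
  have "card (A \<inter> B \<inter> T) + card X = card ((A \<inter> B \<inter> T) \<union> X)"
    by (rule card_Un_disjoint[symmetric]) (use X finXY finite_A in auto)
  also have "\<dots> \<le> card (B \<inter> T)" by (rule card_mono) (use X XT finite_B in auto)
  also have "\<dots> \<le> card (A \<inter> T) + K * K * \<rho>" using T card_Int_le_rank le_trans by blast
  also have "card (A \<inter> T) = card (A \<inter> B \<inter> T) + card ((A - B) \<inter> T)"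
  proof -
    have "A \<inter> T = A \<inter> B \<inter> T \<union> (A - B) \<inter> T" by blast
    then have "card (A \<inter> T) = card (A \<inter> B \<inter> T \<union> (A - B) \<inter> T)" by (rule arg_cong)
    also have "\<dots> = card (A \<inter> B \<inter> T) + card ((A - B) \<inter> T)"
      by (rule card_Un_disjoint) (use finite_A in auto)
    finally show ?thesis .
  qed
  finally have "card X \<le> card ((A - B) \<inter> T) + K * K * \<rho>" by simp
  moreover have "card ((A - B) \<inter> T) + card Y = card (((A - B) \<inter> T) \<union> Y)"
    by (rule card_Un_disjoint[symmetric]) (use YT finXY finite_A in auto)
  moreover have "card (((A - B) \<inter> T) \<union> Y) \<le> card (A - B)"
    by (rule card_mono) (use Y finite_A in auto)
  ultimately show ?thesis by linarith
qed

text \<open>Hall's condition with defect holds because a set \<open>X\<close> and its non-neighbours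
  in \<open>A - B\<close> form a pair to which \<open>card_unexchangeable_le\<close>
  applies.\<close>

lemma class_matching:
  assumes K: "\<And>X. X \<subseteq> B - A \<Longrightarrow> card (key ` X) \<le> K" "\<And>Y. Y \<subseteq> A - B \<Longrightarrow> card (key ` Y) \<le> K"
  shows "\<exists>X \<phi>. X \<subseteq> B - A \<and> card (B - A) \<le> card X + K * K * \<rho> \<and> inj_on \<phi> X \<and>
    (\<forall>x\<in>X. \<phi> x \<in> A - B \<and> exchangeable indep key (A \<union> B) A \<rho> x (\<phi> x))"
proof (rule hall_defect)
  fix X assume X: "X \<subseteq> B - A"
  let ?N = "{y\<in>A - B. \<exists>x\<in>X. exchangeable indep key (A \<union> B) A \<rho> x y}"
  have "card X + card (A - B - ?N) \<le> card (A - B) + K * K * \<rho>"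
    using X by (intro card_unexchangeable_le K) auto
  moreover have "card (A - B - ?N) + card ?N = card (A - B)"
    using finite_A by (subst card_Un_disjoint[symmetric]) (auto intro: arg_cong[of _ _ card])
  ultimately show "card X \<le> card ?N + K * K * \<rho>" by linarith
qed (use finite_A finite_B in auto)

text \<open>Rado's theorem with the class of \<open>x\<close> as the set of candidates for
  \<open>x\<close>. Unions of such candidate sets are class-closed, so the rank condition is needed
  for those sets only.\<close>

lemma basis_by_classes:
  assumes L: "L \<subseteq> A \<union> B" "card L = card A"
    and le: "\<And>Z. class_closed key (A \<union> B) Z \<Longrightarrow> card (L \<inter> Z) \<le> rank indep Z"
  shows "\<exists>\<psi>. inj_on \<psi> L \<and> (\<forall>x\<in>L. key (\<psi> x) = key x) \<and> basis indep (\<psi> ` L)"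
proof -
  define F where "F = (\<lambda>x. {y \<in> A \<union> B. key y = key x})"
  have finL: "finite L" using L finite_A finite_B finite_subset by blast
  have "card K \<le> rank indep (\<Union>x\<in>K. F x)" if "K \<subseteq> L" for K
  proof -
    have "card K \<le> card (L \<inter> (\<Union>x\<in>K. F x))"
      using that L finL by (intro card_mono) (auto simp: F_def)
    also have "\<dots> \<le> rank indep (\<Union>x\<in>K. F x)"
      by (rule le) (auto simp: class_closed_def F_def)
    finally show ?thesis .
  qed
  moreover have "\<forall>x\<in>L. finite (F x)" using finite_A finite_B by (auto simp: F_def)
  ultimately obtain \<psi> where \<psi>: "inj_on \<psi> L" "\<forall>x\<in>L. \<psi> x \<in> F x" "indep (\<psi> ` L)"
    using rado[OF M finL, of F] by blast
  have "basis indep (\<psi> ` L)"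
    using \<psi> L by (intro basis_if_card[OF M A]) (auto simp: card_image)
  then show ?thesis using \<psi> by (auto simp: F_def)
qed

text \<open>If \<open>Z\<close> contains some \<open>x\<close> in \<open>I\<close> but not
  \<open>\<phi> x\<close>, its slack \<open>\<rho>\<close> covers all of \<open>I\<close>. Otherwise
  every element gained inside \<open>Z\<close> is paid for by its partner lost inside
  \<open>Z\<close>.\<close>

lemma class_exchange:
  assumes I: "I \<subseteq> B - A" "card I \<le> \<rho>" and \<phi>: "inj_on \<phi> I"
    "\<And>x. x \<in> I \<Longrightarrow> \<phi> x \<in> A - B" "\<And>x. x \<in> I \<Longrightarrow> exchangeable indep key (A \<union> B) A \<rho> x (\<phi> x)"
  shows "\<exists>\<psi>. inj_on \<psi> ((A - \<phi> ` I) \<union> I) \<and> (\<forall>x\<in>(A - \<phi> ` I) \<union> I. key (\<psi> x) = key x) \<and>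
    basis indep (\<psi> ` ((A - \<phi> ` I) \<union> I))"
proof (rule basis_by_classes[of "(A - \<phi> ` I) \<union> I"])
  have finI: "finite I" by (rule finite_subset[OF I(1)]) (use finite_B in simp)
  have exchanged: "card (S - \<phi> ` J) + card J = card S" if "J \<subseteq> I" "\<phi> ` J \<subseteq> S" "S \<subseteq> A" for J S
  proof -
    have "card (\<phi> ` J) = card J" using inj_on_subset[OF \<phi>(1) that(1)] by (rule card_image)
    moreover have "finite S" using that finite_A finite_subset by blast
    ultimately show ?thesis using that card_mono[of S "\<phi> ` J"]
      by (subst card_Diff_subset) (auto intro: finite_subset)
  qed
  show "(A - \<phi> ` I) \<union> I \<subseteq> A \<union> B" using I by auto
  have "card ((A - \<phi> ` I) \<union> I) = card (A - \<phi> ` I) + card I"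
    using I finI finite_A by (intro card_Un_disjoint) auto
  also have "\<dots> = card A" using \<phi>(2) by (intro exchanged) auto
  finally show "card ((A - \<phi> ` I) \<union> I) = card A" .
  fix Z assume Z: "class_closed key (A \<union> B) Z"
  let ?LZ = "((A - \<phi> ` I) \<union> I) \<inter> Z"
  show "card ?LZ \<le> rank indep Z"
  proof (cases "\<exists>x\<in>I. x \<in> Z \<and> \<phi> x \<notin> Z")
    case True
    have "card ?LZ \<le> card ((A \<inter> Z) \<union> I)" using finite_A finI by (intro card_mono) auto
    also have "\<dots> \<le> card (A \<inter> Z) + \<rho>" using card_Un_le[of "A \<inter> Z" I] I(2) by linarith
    also have "\<dots> \<le> rank indep Z" using True \<phi>(3) Z unfolding exchangeable_def by blast
    finally show ?thesis .
  next
    case False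
    have "card ?LZ \<le> card ((A \<inter> Z - \<phi> ` (I \<inter> Z)) \<union> (I \<inter> Z))"
      using finite_A finI by (intro card_mono) auto
    also have "\<dots> \<le> card (A \<inter> Z - \<phi> ` (I \<inter> Z)) + card (I \<inter> Z)" by (rule card_Un_le)
    also have "\<dots> = card (A \<inter> Z)" using False \<phi>(2) by (intro exchanged) auto
    also have "\<dots> \<le> rank indep Z" by (rule card_Int_le_rank)
    finally show ?thesis .
  qed
qed

end

section \<open>The improvement step and the final bound\<close>

text \<open>In \<open>far\<close>, \<open>\<delta>\<close> allows for the unmatched elements, and
  \<open>w + 2 * D * \<delta>\<close> bounds each coordinate of the summed weight differences of the
  matched pairs. A difference has entries up to \<open>2 * D\<close>, hence \<open>4 * m * D\<close>
  in \<open>\<rho>\<close>.\<close>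

lemma closer_basis:
  fixes W :: "'a \<Rightarrow> nat \<Rightarrow> int" and D m :: nat
  defines "\<rho> \<equiv> (4 * m * D + 3) ^ m"
  defines "\<delta> \<equiv> (2 * D + 1) ^ m * (2 * D + 1) ^ m * \<rho>"
  assumes M: "matroid E indep" and A: "basis indep A" and B: "basis indep B"
    and D: "D \<ge> 1" and W: "\<forall>e\<in>E. \<forall>i<m. \<bar>W e i\<bar> \<le> int D"
    and w: "\<forall>i<m. \<bar>wsum W B i - wsum W A i\<bar> \<le> int w"
    and far: "\<delta> + \<rho> * (w + 2 * D * \<delta>) < card (B - A)"
  shows "\<exists>A'. basis indep A' \<and> (\<forall>i<m. wsum W A' i = wsum W A i) \<and> card (B - A') < card (B - A)"
proof -
  note fin = finite_A[OF M A B] finite_B[OF M A B]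
  have WAB: "\<bar>W x i\<bar> \<le> int D" if "x \<in> A \<union> B" "i < m" for x i
    using that W indep_subset_E[OF M indep_A[OF M A B]] indep_subset_E[OF M indep_B[OF M A B]] by blast
  \<comment> \<open>Recording membership besides the weight lets a class-preserving map respect
    \<open>B\<close>. Within \<open>B - A\<close> or \<open>A - B\<close> the membership part is
    constant, so only the weight vectors are counted.\<close>
  define key where "key = (\<lambda>x. (x \<in> A, x \<in> B, map (W x) [0..<m]))"
  let ?L = "{xs. set xs \<subseteq> {-int D..int D} \<and> length xs = m}"
  have K: "card (key ` X) \<le> (2 * D + 1) ^ m" if "X \<subseteq> A \<union> B" "\<forall>x\<in>X. (x \<in> A) = a \<and> (x \<in> B) = b" for X a b
  proof -
    have "- int D \<le> W x i \<and> W x i \<le> int D" if "x \<in> X" "i < m" for x i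
      using WAB[of x i] that \<open>X \<subseteq> A \<union> B\<close> by (auto simp: abs_le_iff)
    then have "key ` X \<subseteq> (\<lambda>xs. (a, b, xs)) ` ?L"
      using that(2) by (auto simp: key_def intro!: imageI)
    then have "card (key ` X) \<le> card ((\<lambda>xs. (a, b, xs)) ` ?L)"
      by (intro card_mono finite_imageI card_bounded_int_vectors(1))
    also have "\<dots> \<le> card ?L" by (intro card_image_le card_bounded_int_vectors(1))
    finally show ?thesis by (simp only: card_bounded_int_vectors(2))
  qed
  have "\<exists>X \<phi>. X \<subseteq> B - A \<and> card (B - A) \<le> card X + \<delta> \<and> inj_on \<phi> X \<and>
    (\<forall>x\<in>X. \<phi> x \<in> A - B \<and> exchangeable indep key (A \<union> B) A \<rho> x (\<phi> x))"
    unfolding \<delta>_def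
  proof (rule class_matching[OF M A B])
    show "card (key ` X) \<le> (2 * D + 1) ^ m" if "X \<subseteq> B - A" for X
      using that by (intro K[of X False True]) auto
    show "card (key ` X) \<le> (2 * D + 1) ^ m" if "X \<subseteq> A - B" for X
      using that by (intro K[of X True False]) auto
  qed
  then obtain X \<phi> where X: "X \<subseteq> B - A" "card (B - A) \<le> card X + \<delta>" and inj: "inj_on \<phi> X"
    and \<phi>: "\<And>x. x \<in> X \<Longrightarrow> \<phi> x \<in> A - B" "\<And>x. x \<in> X \<Longrightarrow> exchangeable indep key (A \<union> B) A \<rho> x (\<phi> x)"
    by blast
  have finX: "finite X" using X fin finite_subset by blast
  define v where "v = (\<lambda>x i. W x i - W (\<phi> x) i)"
  have many: "\<rho> * (w + 2 * D * \<delta>) \<le> card X" using X(2) far by linarith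
  have rho: "m < \<rho>"
  proof -
    have "m < 2 ^ m" by (rule less_exp)
    also have "(2::nat) ^ m \<le> \<rho>" unfolding \<rho>_def by (intro power_mono) auto
    finally show ?thesis .
  qed
  have "\<delta> \<ge> 1" using rho unfolding \<delta>_def by simp
  then have "2 \<le> w + 2 * D * \<delta>" using D mult_le_mono[of 2 "2 * D" 1 \<delta>] by linarith
  then have "\<rho> * 2 \<le> card X" using many mult_le_mono2 le_trans by blast
  then have large: "\<rho> + m \<le> card X" using rho by linarith
  have sum_le: "\<bar>\<Sum>x\<in>S. W x i\<bar> \<le> int (D * \<delta>)" if "S \<subseteq> A \<union> B" "card S \<le> \<delta>" "i < m" for S i
  proof -
    have "\<bar>\<Sum>x\<in>S. W x i\<bar> \<le> (\<Sum>x\<in>S. \<bar>W x i\<bar>)" by (rule sum_abs)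
    also have "\<dots> \<le> (\<Sum>x\<in>S. int D)" using WAB that by (intro sum_mono) auto
    also have "\<dots> = int (D * card S)" by simp
    also have "\<dots> \<le> int (D * \<delta>)" using that(2) by (intro zle_int[THEN iffD2] mult_le_mono) auto
    finally show ?thesis .
  qed
  have card_\<phi>X: "card (\<phi> ` X) = card X" using inj by (rule card_image)
  \<comment> \<open>The matched differences sum to \<open>W(B) - W(A)\<close> up to the unmatched
    elements, at most \<open>\<delta>\<close> on either side and each of size at most
    \<open>D\<close>.\<close>
  have "\<bar>\<Sum>x\<in>X. v x i\<bar> \<le> int (w + 2 * D * \<delta>)" if i: "i < m" for i
  proof -
    have "card (B - A - X) = card (B - A) - card X"
      using X finX by (intro card_Diff_subset) auto
    then have b: "\<bar>\<Sum>x\<in>B - A - X. W x i\<bar> \<le> int (D * \<delta>)"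
      using X(2) i by (intro sum_le) auto
    have "card (A - B - \<phi> ` X) = card (A - B) - card (\<phi> ` X)"
      using \<phi>(1) finX by (intro card_Diff_subset) auto
    then have a: "\<bar>\<Sum>x\<in>A - B - \<phi> ` X. W x i\<bar> \<le> int (D * \<delta>)"
      using X(2) i card_\<phi>X card_A_Diff_B[OF M A B] by (intro sum_le) auto
    have "wsum W B i = (\<Sum>x\<in>B \<inter> A. W x i) + (\<Sum>x\<in>B - A. W x i)"
      unfolding wsum_def using fin(2) by (rule sum.Int_Diff)
    moreover have "wsum W A i = (\<Sum>x\<in>A \<inter> B. W x i) + (\<Sum>x\<in>A - B. W x i)"
      unfolding wsum_def using fin(1) by (rule sum.Int_Diff)
    moreover have "(\<Sum>x\<in>B - A. W x i) = (\<Sum>x\<in>B - A - X. W x i) + (\<Sum>x\<in>X. W x i)"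
      using X(1) fin by (intro sum.subset_diff) auto
    moreover have "(\<Sum>x\<in>A - B. W x i) = (\<Sum>x\<in>A - B - \<phi> ` X. W x i) + (\<Sum>x\<in>\<phi> ` X. W x i)"
      using \<phi>(1) fin by (intro sum.subset_diff) auto
    moreover have "(\<Sum>x\<in>\<phi> ` X. W x i) = (\<Sum>x\<in>X. W (\<phi> x) i)"
      using inj by (simp add: sum.reindex)
    moreover have "(\<Sum>x\<in>X. v x i) = (\<Sum>x\<in>X. W x i) - (\<Sum>x\<in>X. W (\<phi> x) i)"
      by (simp add: v_def sum_subtractf)
    ultimately have "(\<Sum>x\<in>X. v x i) = wsum W B i - wsum W A i
        - (\<Sum>x\<in>B - A - X. W x i) + (\<Sum>x\<in>A - B - \<phi> ` X. W x i)"
      by (simp add: Int_commute)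
    moreover have "\<bar>wsum W B i - wsum W A i\<bar> \<le> int w" using w i by blast
    ultimately have "\<bar>\<Sum>x\<in>X. v x i\<bar> \<le> int w + int (D * \<delta>) + int (D * \<delta>)" using a b by linarith
    then show ?thesis by simp
  qed
  then have small: "int \<rho> * \<bar>\<Sum>x\<in>X. v x i\<bar> \<le> int (card X)" if "i < m" for i
  proof -
    have "int \<rho> * \<bar>\<Sum>x\<in>X. v x i\<bar> \<le> int \<rho> * int (w + 2 * D * \<delta>)"
      using that \<open>\<And>i. i < m \<Longrightarrow> \<bar>\<Sum>x\<in>X. v x i\<bar> \<le> int (w + 2 * D * \<delta>)\<close> by (intro mult_left_mono) auto
    also have "\<dots> \<le> int (card X)" using many by (metis of_nat_mult zle_int)
    finally show ?thesis .
  qed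
  have "\<forall>x\<in>X. \<forall>i<m. \<bar>v x i\<bar> \<le> int (2 * D)"
  proof (intro ballI allI impI)
    fix x i assume x: "x \<in> X" "i < m"
    then have "\<bar>W x i\<bar> \<le> int D" "\<bar>W (\<phi> x) i\<bar> \<le> int D"
      using X(1) \<phi>(1)[of x] WAB by blast+
    then show "\<bar>v x i\<bar> \<le> int (2 * D)" unfolding v_def by linarith
  qed
  moreover have "\<rho> = (2 * m * (2 * D) + 3) ^ m"
    unfolding \<rho>_def by (rule arg_cong) simp
  ultimately obtain I where I: "I \<subseteq> X" "I \<noteq> {}" "card I \<le> \<rho>" "\<forall>i<m. (\<Sum>x\<in>I. v x i) = 0"
    using zero_sum_subset[OF finX, of m v "2 * D"] large small by auto
  have finI: "finite I" using I finX finite_subset by blast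
  have injI: "inj_on \<phi> I" using inj I(1) by (rule inj_on_subset)
  let ?N = "(A - \<phi> ` I) \<union> I"
  have "\<exists>\<psi>. inj_on \<psi> ?N \<and> (\<forall>x\<in>?N. key (\<psi> x) = key x) \<and> basis indep (\<psi> ` ?N)"
    using I X(1) \<phi> injI by (intro class_exchange[OF M A B]) auto
  then obtain \<psi> where \<psi>: "inj_on \<psi> ?N" "\<And>x. x \<in> ?N \<Longrightarrow> key (\<psi> x) = key x" "basis indep (\<psi> ` ?N)"
    by blast
  have finN: "finite ?N" using fin finI by auto
  have "wsum W (\<psi> ` ?N) i = wsum W A i" if i: "i < m" for i
  proof -
    have "W (\<psi> x) i = W x i" if "x \<in> ?N" for x
      using \<psi>(2)[OF that] i by (simp add: key_def)
    then have "wsum W (\<psi> ` ?N) i = (\<Sum>x\<in>?N. W x i)"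
      unfolding wsum_def using \<psi>(1) by (simp add: sum.reindex)
    also have "\<dots> = (\<Sum>x\<in>A - \<phi> ` I. W x i) + (\<Sum>x\<in>I. W x i)"
      using fin finI I X(1) by (intro sum.union_disjoint) auto
    also have "(\<Sum>x\<in>I. W x i) = (\<Sum>x\<in>\<phi> ` I. W x i)"
      using I(4) i injI by (simp add: v_def sum_subtractf sum.reindex)
    also have "(\<Sum>x\<in>A - \<phi> ` I. W x i) + (\<Sum>x\<in>\<phi> ` I. W x i) = wsum W A i"
      unfolding wsum_def using fin I(1) \<phi>(1) by (intro sum.subset_diff[symmetric]) auto
    finally show ?thesis .
  qed
  moreover have "card (B - \<psi> ` ?N) < card (B - A)"
  proof -
    \<comment> \<open>\<open>?N\<close> keeps all of \<open>A \<inter> B\<close> and gains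
      \<open>I\<close>; since \<open>\<psi>\<close> maps \<open>?N \<inter> B\<close> into
      \<open>B\<close>, the overlap with \<open>B\<close> grows by at least
      \<open>card I\<close>.\<close>
    have "\<psi> ` (?N \<inter> B) \<subseteq> B \<inter> \<psi> ` ?N" using \<psi>(2) by (auto simp: key_def)
    then have "card (\<psi> ` (?N \<inter> B)) \<le> card (B \<inter> \<psi> ` ?N)" using fin by (intro card_mono) auto
    moreover have "card (\<psi> ` (?N \<inter> B)) = card (?N \<inter> B)"
      using \<psi>(1) by (intro card_image) (auto intro: inj_on_subset)
    moreover have "card (?N \<inter> B) = card (B \<inter> A) + card I"
    proof -
      have "?N \<inter> B = (B \<inter> A) \<union> I" using I(1) X(1) \<phi>(1) by blast
      moreover have "card ((B \<inter> A) \<union> I) = card (B \<inter> A) + card I"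
        using I(1) X(1) fin finI by (intro card_Un_disjoint) auto
      ultimately show ?thesis by (simp only:)
    qed
    moreover have "0 < card I" using I(2) finI by (simp add: card_gt_0_iff)
    moreover have "card B = card (B \<inter> A) + card (B - A)"
      "card B = card (B \<inter> \<psi> ` ?N) + card (B - \<psi> ` ?N)"
      using fin by (auto intro: card_Int_Diff)
    ultimately show ?thesis by linarith
  qed
  ultimately show ?thesis using \<psi>(3) by (intro exI[of _ "\<psi> ` ?N"]) blast
qed

text \<open>The left side is twice the threshold of \<open>closer_basis\<close> at
  \<open>w = 1\<close>. With \<open>x = 2 * m * D\<close> it is at most
  \<open>(4 * D + 1) * (\<delta> * \<rho>)\<close>, then \<open>(96 * x ^ 5) ^ m\<close>, and
  \<open>96 \<le> 2 ^ 7 \<le> x ^ 7\<close>.\<close>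

lemma proximity_constant_le:
  fixes D m :: nat
  assumes "D \<ge> 1" "m \<ge> 1"
  defines "\<rho> \<equiv> (4 * m * D + 3) ^ m"
  defines "\<delta> \<equiv> (2 * D + 1) ^ m * (2 * D + 1) ^ m * \<rho>"
  shows "2 * \<delta> + 2 * \<rho> + 4 * D * \<rho> * \<delta> \<le> (2 * m * D) ^ (12 * m)"
proof -
  define x where "x = 2 * m * D"
  have x2: "2 \<le> x" and xD: "2 * D \<le> x"
    using assms(1,2) mult_le_mono[of 1 m 1 D] mult_le_mono1[of 1 m "2 * D"]
    by (auto simp: x_def mult_ac)
  have "2 * (2 * D + 1) = 2 * (2 * D) + 2" by simp
  then have two_D: "2 * (2 * D + 1) \<le> 3 * x" using x2 xD by linarith
  define p where "p = (2 * D + 1)\<^sup>2 * (4 * m * D + 3)\<^sup>2"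
  have pm: "\<delta> * \<rho> = p ^ m"
    by (simp only: \<delta>_def \<rho>_def p_def power_mult_distrib power2_eq_square mult_ac)
  \<comment> \<open>The factor 4 avoids fractions; squaring yields
    \<open>16 * p \<le> 441 * x ^ 4\<close>.\<close>
  have "4 * ((2 * D + 1) * (4 * m * D + 3)) = (2 * (2 * D + 1)) * (2 * (2 * x + 3))"
    by (simp add: x_def algebra_simps)
  also have "\<dots> \<le> (3 * x) * (7 * x)" using x2 by (intro mult_le_mono[OF two_D]) simp
  finally have "(4 * ((2 * D + 1) * (4 * m * D + 3)))\<^sup>2 \<le> (21 * x\<^sup>2)\<^sup>2"
    by (intro power_mono) (auto simp: power2_eq_square)
  moreover have "(4 * ((2 * D + 1) * (4 * m * D + 3)))\<^sup>2 = 16 * p"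
    by (simp only: p_def power_mult_distrib) simp
  moreover have "(21 * x\<^sup>2)\<^sup>2 = 441 * x ^ 4" by (simp add: power_mult_distrib)
  ultimately have p: "p \<le> 32 * x ^ 4" by linarith
  have r4: "4 \<le> \<rho>"
  proof -
    have "4 * m * D + 3 \<le> \<rho>" unfolding \<rho>_def using assms(2) by (intro self_le_power) auto
    moreover have "1 \<le> m * D" using assms(1,2) mult_le_mono[of 1 m 1 D] by simp
    ultimately show ?thesis unfolding mult.assoc by linarith
  qed
  have "\<rho> \<le> \<delta>" unfolding \<delta>_def by simp
  then have "2 * \<delta> + 2 * \<rho> \<le> \<delta> * 4" by linarith
  also have "\<dots> \<le> \<delta> * \<rho>" using r4 by (intro mult_le_mono) auto
  finally have "2 * \<delta> + 2 * \<rho> + 4 * D * \<rho> * \<delta> \<le> (4 * D + 1) * (\<delta> * \<rho>)"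
    by (simp add: algebra_simps)
  also have "\<dots> \<le> (3 * x) * (32 * x ^ 4) ^ m"
    unfolding pm using x2 xD p by (intro mult_le_mono power_mono) auto
  also have "\<dots> \<le> (3 * x) ^ m * (32 * x ^ 4) ^ m"
    using x2 assms(2) by (intro mult_le_mono self_le_power) auto
  also have "\<dots> = (96 * x ^ 5) ^ m"
  proof -
    have "(3 * x) * (32 * x ^ 4) = 96 * x ^ 5" using power_Suc[of x 4] by simp
    then show ?thesis by (simp only: power_mult_distrib[symmetric])
  qed
  also have "\<dots> \<le> (x ^ 7 * x ^ 5) ^ m"
  proof (intro power_mono mult_le_mono)
    have "(2::nat) ^ 7 \<le> x ^ 7" using x2 by (rule power_mono) simp
    then show "96 \<le> x ^ 7" by simp
  qed auto
  also have "\<dots> = x ^ (12 * m)" by (simp flip: power_add add: power_mult)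
  finally show ?thesis unfolding x_def .
qed

theorem theorem1:
  fixes E :: "'a set" and indep :: "'a set \<Rightarrow> bool"
    and W :: "'a \<Rightarrow> nat \<Rightarrow> int" and m :: nat and \<Delta> :: int
    and A B :: "'a set"
  assumes "matroid E indep"
    and "m \<ge> 1" and "\<Delta> \<ge> 1"
    and "\<forall>e\<in>E. \<forall>i<m. \<bar>W e i\<bar> \<le> \<Delta>"
    and "basis indep A" and "basis indep B"
  shows "\<exists>A'. basis indep A' \<and> (\<forall>i<m. wsum W A' i = wsum W A i) \<and>
           int (card (symdiff A' B)) \<le>
             (2 * int m * \<Delta>) ^ (12 * m) * (\<Sum>i<m. \<bar>wsum W B i - wsum W A i\<bar>)"
proof -
  define D where "D = nat \<Delta>"
  have D: "D \<ge> 1" "\<Delta> = int D" using assms(3) by (auto simp: D_def)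
  define w where "w = nat (\<Sum>i<m. \<bar>wsum W B i - wsum W A i\<bar>)"
  have w: "(\<Sum>i<m. \<bar>wsum W B i - wsum W A i\<bar>) = int w" by (simp add: w_def sum_nonneg)
  have wi: "\<bar>wsum W B i - wsum W A i\<bar> \<le> int w" if "i < m" for i
    unfolding w[symmetric] using that
    by (intro member_le_sum[of i "{..<m}" "\<lambda>i. \<bar>wsum W B i - wsum W A i\<bar>"]) auto
  show ?thesis
  proof (cases "w = 0")
    \<comment> \<open>The bound is 0 here, so \<open>B\<close> itself has to be the witness.\<close>
    case True
    then have "\<forall>i<m. wsum W B i = wsum W A i" using wi by force
    moreover have "symdiff B B = {}" by (simp add: symdiff_def)
    ultimately show ?thesis using assms(6) w True by (intro exI[of _ B]) auto
  next
    case False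
    define \<rho> where "\<rho> = (4 * m * D + 3) ^ m"
    define \<delta> where "\<delta> = (2 * D + 1) ^ m * (2 * D + 1) ^ m * \<rho>"
    let ?P = "\<lambda>A'. basis indep A' \<and> (\<forall>i<m. wsum W A' i = wsum W A i)"
    obtain C where C: "?P C" and least: "\<And>C'. ?P C' \<Longrightarrow> card (B - C) \<le> card (B - C')"
      using ex_has_least_nat[of ?P A "\<lambda>C. card (B - C)"] assms(5) by blast
    have "card (B - C) \<le> \<delta> + \<rho> * (w + 2 * D * \<delta>)"
    proof (rule ccontr)
      assume "\<not> ?thesis"
      then have "\<exists>C'. basis indep C' \<and> (\<forall>i<m. wsum W C' i = wsum W C i) \<and> card (B - C') < card (B - C)"
        using assms C D wi unfolding \<delta>_def \<rho>_def
        by (intro closer_basis[where E = E and D = D and w = w]) auto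
      then show False using C least by (metis leD)
    qed
    moreover have "card (symdiff C B) = card (C - B) + card (B - C)"
      unfolding symdiff_def using C assms finite_A[OF assms(1), of C B] finite_B[OF assms(1), of C B]
      by (intro card_Un_disjoint) auto
    moreover have "card (C - B) = card (B - C)" using C assms by (intro card_A_Diff_B) auto
    ultimately have "card (symdiff C B) \<le> 2 * \<delta> + 2 * \<rho> * w + 4 * D * \<rho> * \<delta>"
      by (simp add: algebra_simps)
    \<comment> \<open>As \<open>w \<ge> 1\<close>, the terms free of \<open>w\<close> may be
      multiplied by it.\<close>
    also have "\<dots> \<le> 2 * \<delta> * w + 2 * \<rho> * w + 4 * D * \<rho> * \<delta> * w"
      using False by (intro add_mono) auto
    also have "\<dots> = (2 * \<delta> + 2 * \<rho> + 4 * D * \<rho> * \<delta>) * w" by (simp add: algebra_simps)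
    also have "\<dots> \<le> (2 * m * D) ^ (12 * m) * w"
      using proximity_constant_le[OF D(1) assms(2)] unfolding \<delta>_def \<rho>_def by (intro mult_le_mono1)
    finally have "int (card (symdiff C B)) \<le> int ((2 * m * D) ^ (12 * m) * w)" by (simp only: zle_int)
    also have "\<dots> = (2 * int m * \<Delta>) ^ (12 * m) * int w" by (simp add: D(2))
    finally show ?thesis using C w by auto
  qed
qed

end
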